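(* Let $\tilde L\in\mathbb{R}^{n\times n}$ be a standardized Laplacian matrix and let $P=\tilde L+J$, where $J$ is the $n\times n$ matrix with all entries $1/n$. Then $\tilde L$ and $P$ are semiconvergent, i.e., the limits $\lim_{k\to\infty}\tilde L^k$ and $\lim_{k\to\infty}P^k$ exist.
   Context: A standardized Laplacian matrix of order $n$ is a real matrix $\tilde L=(\ell_{ij})\in\mathbb{R}^{n\times n}$ such that $-\frac1n\le \ell_{ij}\le 0$ for all $j\ne i$ and $\sum_{j=1}^n \ell_{ij}=0$ for every $i$. *)

theory Defs
  imports "HOL-Analysis.Analysis"
begin

definition standardized_laplacian :: "real ^ 'n ^ 'n \<Rightarrow> bool" where
  "standardized_laplacian L \<longleftrightarrow>
     (\<forall>i j. j \<noteq> i \<longrightarrow> - (1 / real CARD('n)) \<le> L $ i $ j \<and> L $ i $ j \<le> 0) \<and>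
     (\<forall>i. (\<Sum>j\<in>UNIV. L $ i $ j) = 0)"

definition J_matrix :: "real ^ 'n ^ 'n" where
  "J_matrix = (\<chi> i j. 1 / real CARD('n))"

(* The overloaded operators * and ^ on the vector types act componentwise,
   so the power with respect to the matrix product is defined here. *)
primrec matrix_power :: "real ^ 'n ^ 'n \<Rightarrow> nat \<Rightarrow> real ^ 'n ^ 'n" where
  "matrix_power A 0 = mat 1"
| "matrix_power A (Suc k) = A ** matrix_power A k"

definition semiconvergent :: "real ^ 'n ^ 'n \<Rightarrow> bool" where
  "semiconvergent A \<longleftrightarrow> convergent (\<lambda>k. matrix_power A k)"

end

theory Submission
  imports Defs
begin

text \<open>
  The matrix \<open>P\<close> is row stochastic with positive diagonal, hence nonexpansive for the
  maximum norm. Let \<open>z\<close> be a limit point of an orbit \<open>P\<^sup>k x\<close>. The norms of the increments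
  \<open>P\<^sup>k\<^sup>+\<^sup>1 x - P\<^sup>k x\<close> decrease to some \<open>d\<close>, so all increments of the orbit of \<open>z\<close>
  have norm exactly \<open>d\<close>. If the increment at time \<open>N\<close> attains \<open>d\<close> in coordinate \<open>i\<close>, then,
  because the \<open>i\<close>-th diagonal entry is positive, every earlier increment takes the same value in
  coordinate \<open>i\<close>; thus coordinate \<open>i\<close> travels a distance \<open>(N + 1) d\<close>. Orbits being bounded,
  \<open>d = 0\<close>, so \<open>z\<close> is a fixed point, and by nonexpansiveness the whole orbit converges to \<open>z\<close>.
  For \<open>L\<close>, the vanishing row sums give \<open>L J = 0\<close>, hence \<open>L\<^sup>k\<^sup>+\<^sup>1 = L P\<^sup>k\<close>.
\<close>

definition row_stochastic :: "real ^ 'n ^ 'n \<Rightarrow> bool" where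
  "row_stochastic A \<longleftrightarrow> (\<forall>i j. 0 \<le> A $ i $ j) \<and> (\<forall>i. (\<Sum>j\<in>UNIV. A $ i $ j) = 1)"

lemma infnorm_le_cart:
  fixes x :: "real ^ 'n"
  assumes "\<And>i. \<bar>x $ i\<bar> \<le> b"
  shows "infnorm x \<le> b"
  unfolding infnorm_cart using assms by (intro cSup_least) auto

text \<open>Over a finite index type the supremum is a maximum. This supplies the extremal
  coordinate that is followed back in time below.\<close>

lemma infnorm_attained_cart:
  fixes x :: "real ^ 'n"
  obtains i where "\<bar>x $ i\<bar> = infnorm x"
proof -
  have "{\<bar>x $ i\<bar> |i. i \<in> UNIV} = range (\<lambda>i. \<bar>x $ i\<bar>)"
    by auto
  then have "infnorm x \<in> range (\<lambda>i. \<bar>x $ i\<bar>)"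
    unfolding infnorm_cart by (simp add: cSup_eq_Max)
  then show ?thesis
    using that by auto
qed

text \<open>Each coordinate of \<open>A *v x\<close> is a weighted average of the coordinates of
  \<open>x\<close>.\<close>

lemma infnorm_stochastic_mult_le:
  fixes A :: "real ^ 'n ^ 'n"
  assumes "row_stochastic A"
  shows "infnorm (A *v x) \<le> infnorm x"
proof (rule infnorm_le_cart)
  fix i
  have "\<bar>(A *v x) $ i\<bar> \<le> (\<Sum>j\<in>UNIV. \<bar>A $ i $ j * x $ j\<bar>)"
    by (simp add: matrix_vector_mult_def)
  also have "\<dots> \<le> (\<Sum>j\<in>UNIV. A $ i $ j * infnorm x)"
    using assms by (intro sum_mono)
      (auto simp: row_stochastic_def abs_mult intro!: mult_left_mono component_le_infnorm_cart)
  also have "\<dots> = infnorm x"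
    using assms by (simp add: row_stochastic_def flip: sum_distrib_right)
  finally show "\<bar>(A *v x) $ i\<bar> \<le> infnorm x" .
qed

text \<open>A weighted average of numbers at most \<open>d\<close> equals \<open>d\<close> only if
  every entry with positive weight equals \<open>d\<close>.\<close>

lemma stochastic_mult_attains_max:
  fixes A :: "real ^ 'n ^ 'n"
  assumes "row_stochastic A" "0 < A $ i $ i" "\<And>j. x $ j \<le> d" "(A *v x) $ i = d"
  shows "x $ i = d"
proof -
  have "(\<Sum>j\<in>UNIV. A $ i $ j * (d - x $ j)) = 0"
    using assms(1,4)
    by (simp add: row_stochastic_def matrix_vector_mult_def right_diff_distrib sum_subtractf
        flip: sum_distrib_right)
  moreover have "\<forall>j. 0 \<le> A $ i $ j * (d - x $ j)"
    using assms(1,3) by (auto simp: row_stochastic_def)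
  ultimately have "A $ i $ i * (d - x $ i) = 0"
    by (simp add: sum_nonneg_eq_0_iff)
  then show ?thesis
    using assms(2) by simp
qed

text \<open>According to the sign of the extremal coordinate, the one-sided version applies to
  \<open>x\<close> or to \<open>- x\<close>.\<close>

lemma stochastic_mult_attains_infnorm:
  fixes A :: "real ^ 'n ^ 'n"
  assumes A: "row_stochastic A" "0 < A $ i $ i"
    and d: "infnorm x \<le> d" "\<bar>(A *v x) $ i\<bar> = d"
  shows "x $ i = (A *v x) $ i"
proof -
  have x: "x $ j \<le> d" "- x $ j \<le> d" for j
    using component_le_infnorm_cart[of x j] d(1) by auto
  show ?thesis
  proof (cases "(A *v x) $ i \<ge> 0")
    case True
    then show ?thesis
      using stochastic_mult_attains_max[OF A x(1)] d(2) by simp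
  next
    case False
    have "A *v (- x) = - (A *v x)"
      by (simp add: vec.neg)
    then have "(- x) $ i = d"
      using stochastic_mult_attains_max[OF A, of "- x" d] x(2) d(2) False by simp
    then show ?thesis
      using d(2) False by simp
  qed
qed

lemma convergent_stochastic_orbit:
  fixes A :: "real ^ 'n ^ 'n"
  assumes A: "row_stochastic A" and diag: "\<And>i. 0 < A $ i $ i"
    and X: "\<And>k. X (Suc k) = A *v X k"
  shows "convergent X"
proof -
  have X_le: "infnorm (X k) \<le> infnorm (X 0)" for k
  proof (induction k)
    case (Suc k)
    then show ?case
      unfolding X using infnorm_stochastic_mult_le[OF A] order_trans by blast
  qed simp
  have "bounded (range X)"
    unfolding bounded_iff
  proof (intro exI ballI)
    fix y assume "y \<in> range X"
    then have "infnorm y \<le> infnorm (X 0)"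
      using X_le by auto
    \<comment> \<open>The factor is the constant comparing the Euclidean norm with the maximum
      norm.\<close>
    then show "norm y \<le> sqrt DIM(real ^ 'n) * infnorm (X 0)"
      by (intro order_trans[OF norm_le_infnorm] mult_left_mono) simp_all
  qed
  then obtain z r where r: "strict_mono r" and z: "(X \<circ> r) \<longlonglongrightarrow> z"
    using bounded_imp_convergent_subsequence by blast
  define D where "D k = X (Suc k) - X k" for k
  have D_Suc: "D (Suc k) = A *v D k" for k
    by (simp add: D_def X matrix_vector_mult_diff_distrib)
  have "decseq (\<lambda>k. infnorm (D k))"
    by (intro decseq_SucI) (simp add: D_Suc infnorm_stochastic_mult_le[OF A])
  then obtain d where d: "(\<lambda>k. infnorm (D k)) \<longlonglongrightarrow> d"
    using decseq_convergent[of "\<lambda>k. infnorm (D k)" 0] infnorm_pos_le by blast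
  define Z where "Z j = ((*v) A ^^ j) z" for j
  define E where "E j = Z (Suc j) - Z j" for j
  have Z_Suc: "Z (Suc j) = A *v Z j" for j
    by (simp add: Z_def)
  have E_Suc: "E (Suc j) = A *v E j" for j
    by (simp add: E_def Z_Suc matrix_vector_mult_diff_distrib)
  have Z_lim: "(\<lambda>k. X (r k + j)) \<longlonglongrightarrow> Z j" for j
  proof (induction j)
    case 0
    then show ?case
      using z by (simp add: Z_def o_def)
  next
    case (Suc j)
    have "(\<lambda>k. A *v X (r k + j)) \<longlonglongrightarrow> A *v Z j"
      by (intro bounded_linear.tendsto[OF _ Suc] matrix_vector_mul_bounded_linear)
    then show ?case
      by (simp add: X Z_Suc)
  qed
  \<comment> \<open>The norms of \<open>D (r k + j)\<close> tend to \<open>infnorm (E j)\<close> by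
    continuity, and to \<open>d\<close> as a subsequence of a convergent sequence.\<close>
  have E_norm: "infnorm (E j) = d" for j
  proof (rule LIMSEQ_unique)
    show "(\<lambda>k. infnorm (D (r k + j))) \<longlonglongrightarrow> infnorm (E j)"
      unfolding D_def E_def using Z_lim[of j] Z_lim[of "Suc j"]
      by (intro tendsto_infnorm tendsto_diff) simp_all
    have "filterlim (\<lambda>k. r k + j) sequentially sequentially"
      using filterlim_compose[OF filterlim_add_const_nat_at_top filterlim_subseq[OF r]] .
    then show "(\<lambda>k. infnorm (D (r k + j))) \<longlonglongrightarrow> d"
      by (rule filterlim_compose[OF d])
  qed
  have Z_le: "infnorm (Z j) \<le> infnorm z" for j
  proof (induction j)
    case (Suc j)
    then show ?case
      unfolding Z_Suc using infnorm_stochastic_mult_le[OF A] order_trans by blast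
  qed (simp add: Z_def)
  have Nd: "real (Suc N) * d \<le> 2 * infnorm z" for N
  proof -
    obtain i where i: "\<bar>E N $ i\<bar> = d"
      using infnorm_attained_cart E_norm by metis
    \<comment> \<open>Induction downwards from \<open>N\<close>: once \<open>E (Suc n) $ i\<close>
      equals \<open>E N $ i\<close>, its modulus is \<open>d\<close>, so its value passes back to
      \<open>E n $ i\<close>.\<close>
    have E_const: "E j $ i = E N $ i" if "j \<le> N" for j
      using that
    proof (induction rule: inc_induct)
      case (step n)
      then show ?case
        using stochastic_mult_attains_infnorm[OF A diag, of "E n" d i] E_Suc E_norm i by simp
    qed simp
    \<comment> \<open>The increments agree in sign as well as in size, so nothing cancels in the
      telescoping sum.\<close>
    have "Z (Suc N) $ i - Z 0 $ i = (\<Sum>j<Suc N. E j $ i)"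
      unfolding E_def vector_minus_component
      by (rule sum_lessThan_telescope[where f = "\<lambda>j. Z j $ i", symmetric])
    also have "\<dots> = (\<Sum>j<Suc N. E N $ i)"
      by (intro sum.cong E_const) auto
    also have "\<dots> = real (Suc N) * E N $ i"
      by simp
    finally have "real (Suc N) * d = \<bar>Z (Suc N) $ i - Z 0 $ i\<bar>"
      using i by (simp add: abs_mult)
    also have "\<dots> \<le> 2 * infnorm z"
      using component_le_infnorm_cart[of "Z (Suc N)" i] component_le_infnorm_cart[of "Z 0" i]
        Z_le[of "Suc N"] Z_le[of 0] by linarith
    finally show ?thesis .
  qed
  have "d \<le> 0"
  proof (rule ccontr)
    assume "\<not> d \<le> 0"
    then obtain N where "2 * infnorm z < real N * d"
      using reals_Archimedean3[of d] by auto
    then show False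
      using Nd[of N] \<open>\<not> d \<le> 0\<close> by (simp add: algebra_simps)
  qed
  then have "E 0 = 0"
    using E_norm[of 0] infnorm_pos_le[of "E 0"] by (simp add: infnorm_eq_0)
  then have fixed: "A *v z = z"
    by (simp add: E_def Z_def)
  have "decseq (\<lambda>k. infnorm (X k - z))"
  proof (rule decseq_SucI)
    fix k
    have "X (Suc k) - z = A *v (X k - z)"
      by (simp add: X fixed matrix_vector_mult_diff_distrib)
    then show "infnorm (X (Suc k) - z) \<le> infnorm (X k - z)"
      using infnorm_stochastic_mult_le[OF A] by simp
  qed
  then obtain e where e: "(\<lambda>k. infnorm (X k - z)) \<longlonglongrightarrow> e"
    using decseq_convergent[of "\<lambda>k. infnorm (X k - z)" 0] infnorm_pos_le by blast
  \<comment> \<open>The distances to \<open>z\<close> already converge, so their limit can be read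
    off along \<open>r\<close>.\<close>
  have "(\<lambda>k. infnorm ((X \<circ> r) k - z)) \<longlonglongrightarrow> infnorm (z - z)"
    by (intro tendsto_intros tendsto_infnorm z)
  moreover have "(\<lambda>k. infnorm ((X \<circ> r) k - z)) \<longlonglongrightarrow> e"
    using LIMSEQ_subseq_LIMSEQ[OF e r] by (simp add: o_def)
  ultimately have "e = 0"
    using LIMSEQ_unique by (fastforce simp: infnorm_0)
  then have lim0: "(\<lambda>k. sqrt DIM(real ^ 'n) * infnorm (X k - z)) \<longlonglongrightarrow> 0"
    using tendsto_mult_right_zero[of _ sequentially] e by blast
  have "(\<lambda>k. X k - z) \<longlonglongrightarrow> 0"
    by (rule Lim_null_comparison[OF _ lim0]) (simp add: norm_le_infnorm del: DIM_cart)
  then show ?thesis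
    unfolding convergent_def by (auto simp: LIM_zero_iff)
qed

text \<open>Applied to the axis vectors, the hypothesis gives convergence of the columns, hence of
  all entries.\<close>

lemma convergent_matrix_columns:
  fixes M :: "nat \<Rightarrow> real ^ 'n ^ 'm"
  assumes "\<And>x. convergent (\<lambda>k. M k *v x)"
  shows "convergent M"
proof -
  obtain l where l: "\<And>x. (\<lambda>k. M k *v x) \<longlonglongrightarrow> l x"
    using assms unfolding convergent_def by metis
  have "(\<lambda>k. M k $ i $ j) \<longlonglongrightarrow> l (axis j 1) $ i" for i j
    using tendsto_vec_nth[OF l[of "axis j 1"], of i]
    by (simp add: matrix_vector_mul_component inner_axis)
  then have "M \<longlonglongrightarrow> (\<chi> i j. l (axis j 1) $ i)"
    by (intro vec_tendstoI) simp
  then show ?thesis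
    by (rule convergentI)
qed

lemma semiconvergent_stochastic:
  fixes A :: "real ^ 'n ^ 'n"
  assumes "row_stochastic A" "\<And>i. 0 < A $ i $ i"
  shows "semiconvergent A"
  unfolding semiconvergent_def
  by (intro convergent_matrix_columns convergent_stochastic_orbit[OF assms])
    (simp add: matrix_vector_mul_assoc)

text \<open>The diagonal entry is minus a sum of nonpositive entries. Adding \<open>J_matrix\<close>
  then makes the diagonal strictly positive.\<close>

lemma standardized_laplacian_diag_nonneg:
  fixes L :: "real ^ 'n ^ 'n"
  assumes "standardized_laplacian L"
  shows "0 \<le> L $ i $ i"
proof -
  have "(\<Sum>j\<in>UNIV. L $ i $ j) = L $ i $ i + (\<Sum>j\<in>UNIV - {i}. L $ i $ j)"
    by (rule sum.remove) simp_all
  moreover have "(\<Sum>j\<in>UNIV - {i}. L $ i $ j) \<le> 0"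
    using assms by (intro sum_nonpos) (auto simp: standardized_laplacian_def)
  ultimately show ?thesis
    using assms by (simp add: standardized_laplacian_def)
qed

lemma matrix_power_Suc_laplacian:
  fixes L :: "real ^ 'n ^ 'n"
  assumes "\<And>i. (\<Sum>j\<in>UNIV. L $ i $ j) = 0"
  shows "matrix_power L (Suc k) = L ** matrix_power (L + J_matrix) k"
proof (induction k)
  case (Suc k)
  have "L ** J_matrix = 0"
    using assms by (simp add: matrix_matrix_mult_def J_matrix_def vec_eq_iff flip: sum_divide_distrib)
  then have "L ** L = L ** (L + J_matrix)"
    by (simp add: matrix_add_ldistrib)
  \<comment> \<open>With \<open>P = L + J_matrix\<close>, the induction hypothesis turns the next
    power of \<open>L\<close> into \<open>(L ** L) ** matrix_power P k\<close>, where
    \<open>L ** L\<close> is replaced by \<open>L ** P\<close>.\<close>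
  then show ?case
    using Suc by (metis matrix_mul_assoc matrix_power.simps(2))
qed simp

theorem theorem3:
  fixes L P :: "real ^ 'n ^ 'n"
  assumes "standardized_laplacian L"
    and "P = L + J_matrix"
  shows "semiconvergent L \<and> semiconvergent P"
proof
  have sum0: "\<And>i. (\<Sum>j\<in>UNIV. L $ i $ j) = 0"
    using assms(1) by (simp add: standardized_laplacian_def)
  have diag: "0 < P $ i $ i" for i
    using standardized_laplacian_diag_nonneg[OF assms(1), of i]
    by (simp add: assms(2) J_matrix_def add_nonneg_pos)
  have "0 \<le> P $ i $ j" for i j
  proof (cases "j = i")
    case True
    then show ?thesis
      using diag[of i] by simp
  next
    case False
    then have "- (1 / real CARD('n)) \<le> L $ i $ j"
      using assms(1) by (simp add: standardized_laplacian_def)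
    then show ?thesis
      by (simp add: assms(2) J_matrix_def)
  qed
  moreover have "(\<Sum>j\<in>UNIV. P $ i $ j) = 1" for i
    using sum0 by (simp add: assms(2) J_matrix_def sum.distrib)
  ultimately have "row_stochastic P"
    by (simp add: row_stochastic_def)
  then show P: "semiconvergent P"
    using diag by (rule semiconvergent_stochastic)
  then obtain Q where "matrix_power P \<longlonglongrightarrow> Q"
    by (auto simp: semiconvergent_def convergent_def)
  \<comment> \<open>Left multiplication by \<open>L\<close> is continuous, each entry being a finite
    sum of products.\<close>
  then have "(\<lambda>k. L ** matrix_power P k) \<longlonglongrightarrow> L ** Q"
    unfolding matrix_matrix_mult_def
    by (intro vec_tendstoI) (auto intro!: tendsto_sum tendsto_mult tendsto_vec_nth)
  then have "(\<lambda>k. matrix_power L (Suc k)) \<longlonglongrightarrow> L ** Q"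
    unfolding matrix_power_Suc_laplacian[OF sum0] assms(2) .
  then show "semiconvergent L"
    unfolding semiconvergent_def by (metis LIMSEQ_imp_Suc convergentI)
qed

end
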